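(* Let $a>0$, let $\pi_0$ be the elicited prior density and $q\in Q$ a contaminating prior density, and for $0\le\epsilon\le 1$ let $$\pi(\theta)=\pi_\epsilon(\theta)=(1-\epsilon)\pi_0(\theta)+\epsilon\, q(\theta)$$ be the corresponding member of the $\epsilon$-contaminated class $\Gamma_a=\{\pi:\ \pi(\theta)=(1-\epsilon)\pi_0(\theta)+\epsilon q(\theta),\ q\in Q\}$. Let $d=d(\epsilon)=d(\pi(\theta|x),\pi_0(\theta|x))$ be the R\'enyi divergence of order $a$ between the posterior density $\pi(\theta|x)$ under $\pi_\epsilon$ and the posterior density $\pi_0(\theta|x)$ under $\pi_0$. Then the local curvature of the R\'enyi divergence at $\epsilon=0$ is $$C_a^{\Gamma_a}=\frac{\partial^2 d}{\partial\epsilon^2}\bigg|_{\epsilon=0}=a\,\mathrm{Var}_{\pi_0(\theta|x)}\left[\frac{q(\theta)}{\pi_0(\theta)}\right],$$ where $\mathrm{Var}_{\pi_0(\theta|x)}$ denotes the variance with respect to the density $\pi_0(\theta|x)$.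
   Context: A statistical model is given by densities $f_\theta(x)$ (with respect to some measure), $\theta\in\Theta$. The data $x$ is fixed. $Q$ is a class of probability densities on $\Theta$; $\pi_0$ and $q\in Q$ are fixed probability densities on $\Theta$, both strictly positive on $\Theta$ (so that $q/\pi_0$ is defined). For a prior density $\pi$ on $\Theta$, the prior predictive density is $m(x|\pi)=\int f_\theta(x)\pi(\theta)\,d\theta$ and the posterior density is $\pi(\theta|x)=f_\theta(x)\pi(\theta)/m(x|\pi)$. It is assumed that $0<m(x|\pi_0)<\infty$ and $0<m(x|q)<\infty$, so that the posteriors are defined. R\'enyi divergence of order $a>0$, $a\neq 1$, between posterior densities: $$d(\pi(\theta|x),\pi_0(\theta|x))=\frac{1}{a-1}\ln\left(\int (\pi(\theta|x))^a(\pi_0(\theta|x))^{1-a}\,d\theta\right).$$ For $a=1$ it is defined by the limit $a\to1$, i.e. the Kullback-Leibler divergence $\int \pi(\theta|x)\ln\frac{\pi(\theta|x)}{\pi_0(\theta|x)}\,d\theta$. All integrals over posteriors are taken over $\{\theta: f_\theta(x)>0\}$. Derivatives in $\epsilon$ at $\epsilon=0$ are understood as one-sided (right) derivatives, since $0\le\epsilon\le1$. Standing regularity assumption: for $\epsilon$ in some interval $[0,\epsilon_0)$ with $\epsilon_0>0$, the divergence is finite, the quantities involved are twice differentiable in $\epsilon$, and differentiation in $\epsilon$ (up to second order) may be interchanged with integration over $\theta$, namely in $\int \pi(\theta|x)\,d\theta$ and in $\int (\pi(\theta|x))^a(\pi_0(\theta|x))^{1-a}\,d\theta$ (for $a=1$,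 in $\int \pi(\theta|x)\ln(\pi(\theta|x)/\pi_0(\theta|x))\,d\theta$), all the resulting integrals being finite. *)

theory Defs
  imports "HOL-Probability.Probability"
begin

definition prob_density :: "'a measure \<Rightarrow> ('a \<Rightarrow> real) \<Rightarrow> bool" where
  "prob_density M p \<longleftrightarrow>
     p \<in> borel_measurable M \<and> (\<forall>t\<in>space M. 0 \<le> p t) \<and> (\<integral>\<^sup>+ t. ennreal (p t) \<partial>M) = 1"

text \<open>
  Throughout, \<open>M\<close> is the reference measure \<open>d\<theta>\<close> on the parameter space \<open>\<Theta> = space M\<close>, and
  \<open>f \<theta> x\<close> is the model density at the data point \<open>x\<close>.
\<close>

definition prior_predictive ::
  "'t measure \<Rightarrow> ('t \<Rightarrow> 'x \<Rightarrow> real) \<Rightarrow> 'x \<Rightarrow> ('t \<Rightarrow> real) \<Rightarrow> real" where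
  "prior_predictive M f x \<pi> = (LINT \<theta>|M. f \<theta> x * \<pi> \<theta>)"

definition posterior ::
  "'t measure \<Rightarrow> ('t \<Rightarrow> 'x \<Rightarrow> real) \<Rightarrow> 'x \<Rightarrow> ('t \<Rightarrow> real) \<Rightarrow> 't \<Rightarrow> real" where
  "posterior M f x \<pi> \<theta> = f \<theta> x * \<pi> \<theta> / prior_predictive M f x \<pi>"

definition likelihood_support ::
  "'t measure \<Rightarrow> ('t \<Rightarrow> 'x \<Rightarrow> real) \<Rightarrow> 'x \<Rightarrow> 't set" where
  "likelihood_support M f x = {\<theta> \<in> space M. 0 < f \<theta> x}"

definition contaminated :: "('t \<Rightarrow> real) \<Rightarrow> ('t \<Rightarrow> real) \<Rightarrow> real \<Rightarrow> 't \<Rightarrow> real" where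
  "contaminated \<pi>0 q \<epsilon> \<theta> = (1 - \<epsilon>) * \<pi>0 \<theta> + \<epsilon> * q \<theta>"

text \<open>At \<open>a = 1\<close> the divergence is the Kullback-Leibler divergence (natural logarithm).\<close>

definition renyi_integrand :: "real \<Rightarrow> ('t \<Rightarrow> real) \<Rightarrow> ('t \<Rightarrow> real) \<Rightarrow> 't \<Rightarrow> real" where
  "renyi_integrand a p p0 \<theta> =
     (if a = 1 then p \<theta> * ln (p \<theta> / p0 \<theta>) else p \<theta> powr a * p0 \<theta> powr (1 - a))"

definition renyi_divergence ::
  "'t measure \<Rightarrow> 't set \<Rightarrow> real \<Rightarrow> ('t \<Rightarrow> real) \<Rightarrow> ('t \<Rightarrow> real) \<Rightarrow> real" where
  "renyi_divergence M A a p p0 =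
     (if a = 1 then LINT \<theta>:A|M. renyi_integrand a p p0 \<theta>
      else 1 / (a - 1) * ln (LINT \<theta>:A|M. renyi_integrand a p p0 \<theta>))"

text \<open>
  The integrand \<open>g \<epsilon> \<theta>\<close> is twice differentiable in \<open>\<epsilon> \<in> I\<close>, with derivatives \<open>g1\<close> and \<open>g2\<close>, and both
  differentiations may be carried out under the (finite) integral over \<open>A\<close>. Derivatives
  are relative to \<open>I\<close>, so at a left endpoint of \<open>I\<close> they are right derivatives.
\<close>

definition twice_diff_under_integral ::
  "'t measure \<Rightarrow> 't set \<Rightarrow> real set \<Rightarrow> (real \<Rightarrow> 't \<Rightarrow> real) \<Rightarrow> bool" where
  "twice_diff_under_integral M A I g \<longleftrightarrow>
     (\<exists>g1 g2. \<forall>\<epsilon>\<in>I.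
        (\<forall>\<theta>\<in>A. ((\<lambda>t. g t \<theta>) has_real_derivative g1 \<epsilon> \<theta>) (at \<epsilon> within I) \<and>
                ((\<lambda>t. g1 t \<theta>) has_real_derivative g2 \<epsilon> \<theta>) (at \<epsilon> within I)) \<and>
        set_integrable M A (g \<epsilon>) \<and> set_integrable M A (g1 \<epsilon>) \<and> set_integrable M A (g2 \<epsilon>) \<and>
        ((\<lambda>t. LINT \<theta>:A|M. g t \<theta>) has_real_derivative (LINT \<theta>:A|M. g1 \<epsilon> \<theta>)) (at \<epsilon> within I) \<and>
        ((\<lambda>t. LINT \<theta>:A|M. g1 t \<theta>) has_real_derivative (LINT \<theta>:A|M. g2 \<epsilon> \<theta>)) (at \<epsilon> within I))"

definition has_second_right_derivative :: "(real \<Rightarrow> real) \<Rightarrow> real \<Rightarrow> real \<Rightarrow> bool" where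
  "has_second_right_derivative d D c \<longleftrightarrow>
     (\<exists>\<delta>>0. \<exists>d1. (\<forall>t\<in>{c..<c + \<delta>}. (d has_real_derivative d1 t) (at t within {c..<c + \<delta>})) \<and>
        (d1 has_real_derivative D) (at c within {c..<c + \<delta>}))"

end

theory Submission
  imports Defs
begin

text \<open>
  Let \<open>p\<^sub>0\<close> be the posterior under \<open>\<pi>0\<close>, \<open>r = q / \<pi>0\<close>, and \<open>R = m(x|q) / m(x|\<pi>0)\<close>, which is the
  mean of \<open>r\<close> under \<open>p\<^sub>0\<close>. The posterior under \<open>\<pi>\<^sub>\<epsilon>\<close> is \<open>p\<^sub>0 u\<close> with
  \<open>u = (1 + \<epsilon> (r - 1)) / (1 + \<epsilon> (R - 1))\<close>, and the divergence integrand is \<open>p\<^sub>0 h(u)\<close>, where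
  \<open>h(v) = v ln v\<close> or \<open>h(v) = v\<^sup>a\<close>. As \<open>u(0) = 1\<close>, \<open>u'(0) = r - R\<close> and
  \<open>u''(0) = - 2 (R - 1) (r - R)\<close>, the terms with \<open>h'(1)\<close> integrate to zero, and the second
  derivative of the integral is \<open>h''(1) Var r\<close>. For \<open>a \<noteq> 1\<close> one has
  \<open>h''(1) = a (a - 1)\<close>, and at \<open>\<epsilon> = 0\<close> the integral is \<open>1\<close> with zero first derivative, so
  taking \<open>ln\<close> leaves its second derivative unchanged. Right derivatives are unique, so these are
  the derivatives under the integral that the regularity assumption provides.
\<close>

text \<open>A connected set other than \<open>{t}\<close> has no isolated point, so
  \<open>at t within {c..<e}\<close> is nontrivial and limits along it are unique.\<close>

lemma right_derivative_unique:
  fixes f :: "real \<Rightarrow> real"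
  assumes "t \<in> {c..<e}"
    and "(f has_real_derivative D) (at t within {c..<e})"
    and "(f has_real_derivative D') (at t within {c..<e})"
  shows "D = D'"
proof -
  have "{c..<e} \<noteq> {t}"
  proof
    assume "{c..<e} = {t}"
    moreover have "(t + e) / 2 \<in> {c..<e}" "(t + e) / 2 \<noteq> t"
      using assms(1) by (auto simp: field_simps)
    ultimately show False by blast
  qed
  then have "at t within {c..<e} \<noteq> bot"
    using assms(1) by (simp add: trivial_limit_within connected_imp_perfect)
  then show ?thesis
    using assms(2,3) vector_derivative_unique_within
    by (metis has_real_derivative_iff_has_vector_derivative)
qed

text \<open>The expression is the convex combination of 1 and \<open>s\<close> with weights
  \<open>1 - t\<close> and \<open>t\<close>, and \<open>t < 1\<close> keeps the first weight
  positive.\<close>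

lemma mixture_weight_pos:
  fixes s t :: real
  assumes "0 < s" "0 \<le> t" "t < 1"
  shows "0 < 1 + t * (s - 1)"
proof -
  have "0 < (1 - t) + t * s"
    using assms by (intro add_pos_nonneg) auto
  then show ?thesis by (simp add: algebra_simps)
qed

text \<open>All terms in \<open>t\<close> cancel in the numerator of the quotient rule, so a second
  differentiation only meets the denominator.\<close>

lemma has_real_derivative_mixture_ratio:
  fixes r R t :: real
  assumes "1 + t * (R - 1) \<noteq> 0"
  shows "((\<lambda>t. (1 + t * (r - 1)) / (1 + t * (R - 1))) has_real_derivative
           (r - R) / (1 + t * (R - 1))\<^sup>2) (at t within S)"
proof -
  have "(r - 1) * (1 + t * (R - 1)) - (1 + t * (r - 1)) * (R - 1) = r - R"
    by (simp add: algebra_simps)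
  then show ?thesis
    using assms
    by (auto intro!: derivative_eq_intros simp: power2_eq_square)
qed

lemma has_real_derivative_comp_mixture_ratio:
  fixes h h' :: "real \<Rightarrow> real" and p r R t :: real
  assumes "0 < r" "0 < R" "0 \<le> t" "t < 1"
    and h: "\<And>v. 0 < v \<Longrightarrow> (h has_real_derivative h' v) (at v)"
  shows "((\<lambda>t. p * h ((1 + t * (r - 1)) / (1 + t * (R - 1)))) has_real_derivative
           p * (h' ((1 + t * (r - 1)) / (1 + t * (R - 1))) * ((r - R) / (1 + t * (R - 1))\<^sup>2)))
           (at t within S)"
proof (intro DERIV_cmult DERIV_chain2[OF h has_real_derivative_mixture_ratio])
  show "0 < (1 + t * (r - 1)) / (1 + t * (R - 1))" "1 + t * (R - 1) \<noteq> 0"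
    using mixture_weight_pos[of r t] mixture_weight_pos[of R t] assms by auto
qed

text \<open>This identifies derivatives known only to exist with those from the chain rule. The
  second derivative is taken at 0 alone, where the ratio equals 1, hence the hypothesis on
  \<open>h'\<close> at 1.\<close>

lemma right_derivatives_comp_mixture_ratio:
  fixes h h' :: "real \<Rightarrow> real" and p r R e :: real
  assumes r: "0 < r" and R: "0 < R" and e: "0 < e" "e \<le> 1"
    and h: "\<And>v. 0 < v \<Longrightarrow> (h has_real_derivative h' v) (at v)"
    and h': "(h' has_real_derivative h2) (at 1)"
    and g: "\<And>t. t \<in> {0..<e} \<Longrightarrow> g t = p * h ((1 + t * (r - 1)) / (1 + t * (R - 1)))"
    and g': "\<And>t. t \<in> {0..<e} \<Longrightarrow> (g has_real_derivative g' t) (at t within {0..<e})"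
    and D: "(g' has_real_derivative D) (at 0 within {0..<e})"
  shows "g' 0 = p * (h' 1 * (r - R))"
    and "D = p * (h2 * (r - R)\<^sup>2 - 2 * h' 1 * (R - 1) * (r - R))"
proof -
  define G1 where "G1 t = p * (h' ((1 + t * (r - 1)) / (1 + t * (R - 1))) *
      ((r - R) / (1 + t * (R - 1))\<^sup>2))" for t
  \<comment> \<open>Agreement on the whole interval is required: \<open>D\<close> depends on the
    values of \<open>g'\<close> near 0, not just on \<open>g' 0\<close>.\<close>
  have eq: "g' t = G1 t" if t: "t \<in> {0..<e}" for t
  proof (rule right_derivative_unique[OF t g'[OF t]])
    have "((\<lambda>t. p * h ((1 + t * (r - 1)) / (1 + t * (R - 1)))) has_real_derivative G1 t)
        (at t within {0..<e})"
      unfolding G1_def using t r R e h by (intro has_real_derivative_comp_mixture_ratio) auto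
    then show "(g has_real_derivative G1 t) (at t within {0..<e})"
      by (rule has_field_derivative_transform_within[where d = 1]) (use t g in auto)
  qed
  show "g' 0 = p * (h' 1 * (r - R))"
    using eq[of 0] e by (simp add: G1_def)
  have "((\<lambda>t. (r - R) / (1 + t * (R - 1))\<^sup>2) has_real_derivative - 2 * (R - 1) * (r - R))
      (at 0 within {0..<e})"
    by (auto intro!: derivative_eq_intros simp: algebra_simps)
  moreover have "((\<lambda>t. h' ((1 + t * (r - 1)) / (1 + t * (R - 1)))) has_real_derivative
      h2 * (r - R)) (at 0 within {0..<e})"
    using h' DERIV_chain2[OF _ has_real_derivative_mixture_ratio[of 0 R r "{0..<e}"], of h' h2]
    by simp
  ultimately have "(G1 has_real_derivative
      p * (h2 * (r - R)\<^sup>2 - 2 * h' 1 * (R - 1) * (r - R))) (at 0 within {0..<e})"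
    unfolding G1_def
    by (auto intro!: derivative_eq_intros simp: algebra_simps power2_eq_square)
  moreover have "(G1 has_real_derivative D) (at 0 within {0..<e})"
    using e eq by (intro has_field_derivative_transform_within[OF D, of 1]) auto
  ultimately show "D = p * (h2 * (r - R)\<^sup>2 - 2 * h' 1 * (R - 1) * (r - R))"
    using e by (auto intro: right_derivative_unique)
qed

text \<open>The second derivative of \<open>ln G\<close> is \<open>G'' / G - (G' / G)^2\<close>,
  which reduces to \<open>G2\<close> at \<open>c\<close>. Since \<open>ln\<close> needs a positive
  argument, the interval is first shrunk using continuity of \<open>G\<close> at
  \<open>c\<close>.\<close>

lemma has_second_right_derivative_ln:
  assumes e: "0 < e"
    and G: "\<And>t. t \<in> {c..<c + e} \<Longrightarrow> (G has_real_derivative G1 t) (at t within {c..<c + e})"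
    and G1: "(G1 has_real_derivative G2) (at c within {c..<c + e})"
    and vals: "G c = 1" "G1 c = 0"
  shows "has_second_right_derivative (\<lambda>t. k * ln (G t)) (k * G2) c"
proof -
  have "(G \<longlongrightarrow> 1) (at c within {c..<c + e})"
    using DERIV_continuous[OF G, of c] e vals by (auto simp: continuous_within)
  then have "\<forall>\<^sub>F t in at c within {c..<c + e}. 0 < G t"
    by (rule order_tendstoD) simp
  then obtain d where d: "0 < d" "\<And>t. t \<in> {c..<c + e} \<Longrightarrow> t \<noteq> c \<Longrightarrow> dist t c < d \<Longrightarrow> 0 < G t"
    unfolding eventually_at by blast
  define \<delta> where "\<delta> = min d e"
  have sub: "{c..<c + \<delta>} \<subseteq> {c..<c + e}" and "0 < \<delta>"
    using d e by (auto simp: \<delta>_def)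
  \<comment> \<open>The filter excludes \<open>c\<close> itself; there positivity comes from
    \<open>G c = 1\<close>.\<close>
  have pos: "0 < G t" if "t \<in> {c..<c + \<delta>}" for t
    using that d(2)[of t] vals by (cases "t = c") (auto simp: \<delta>_def dist_real_def)
  have "((\<lambda>t. k * ln (G t)) has_real_derivative k * (G1 t / G t)) (at t within {c..<c + \<delta>})"
    if t: "t \<in> {c..<c + \<delta>}" for t
    using DERIV_subset[OF G sub, of t] t sub pos[OF t]
    by (auto intro!: derivative_eq_intros)
  moreover have "((\<lambda>t. k * (G1 t / G t)) has_real_derivative k * G2) (at c within {c..<c + \<delta>})"
    using DERIV_subset[OF G sub, of c] DERIV_subset[OF G1 sub] e vals
    by (auto intro!: derivative_eq_intros)
  ultimately show ?thesis
    unfolding has_second_right_derivative_def using \<open>0 < \<delta>\<close>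
    by (intro exI[of _ \<delta>] conjI exI[of _ "\<lambda>t. k * (G1 t / G t)"] ballI)
qed

lemma twice_diff_under_integralE:
  assumes "twice_diff_under_integral M A I g"
  obtains g1 g2 where
    "\<forall>t\<in>I. \<forall>\<theta>\<in>A. ((\<lambda>t. g t \<theta>) has_real_derivative g1 t \<theta>) (at t within I)"
    "\<forall>t\<in>I. \<forall>\<theta>\<in>A. ((\<lambda>t. g1 t \<theta>) has_real_derivative g2 t \<theta>) (at t within I)"
    "\<forall>t\<in>I. set_integrable M A (g2 t)"
    "\<forall>t\<in>I. ((\<lambda>t. LINT \<theta>:A|M. g t \<theta>) has_real_derivative
      (LINT \<theta>:A|M. g1 t \<theta>)) (at t within I)"
    "\<forall>t\<in>I. ((\<lambda>t. LINT \<theta>:A|M. g1 t \<theta>) has_real_derivative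
      (LINT \<theta>:A|M. g2 t \<theta>)) (at t within I)"
  using assms unfolding twice_diff_under_integral_def ball_conj_distrib
  by (elim exE conjE) (rule that)

text \<open>The predictive density is linear in the prior, so both prior and predictive density of
  the mixture are those of \<open>\<pi>0\<close> times a factor affine in \<open>t\<close>.\<close>

lemma posterior_contaminated:
  assumes "integrable M (\<lambda>\<theta>. f \<theta> x * \<pi>0 \<theta>)" "0 < prior_predictive M f x \<pi>0"
    and "integrable M (\<lambda>\<theta>. f \<theta> x * q \<theta>)" "0 < prior_predictive M f x q"
    and "0 < \<pi>0 \<theta>" "0 \<le> t" "t < 1"
  shows "posterior M f x (contaminated \<pi>0 q t) \<theta> = posterior M f x \<pi>0 \<theta> *
    ((1 + t * (q \<theta> / \<pi>0 \<theta> - 1)) /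
     (1 + t * (prior_predictive M f x q / prior_predictive M f x \<pi>0 - 1)))"
proof -
  define m0 mq where "m0 = prior_predictive M f x \<pi>0" and "mq = prior_predictive M f x q"
  have "prior_predictive M f x (contaminated \<pi>0 q t) =
      (LINT \<theta>|M. (1 - t) * (f \<theta> x * \<pi>0 \<theta>) + t * (f \<theta> x * q \<theta>))"
    unfolding prior_predictive_def contaminated_def by (simp add: algebra_simps)
  also have "\<dots> = (1 - t) * m0 + t * mq"
    using assms(1,3) by (simp add: m0_def mq_def prior_predictive_def)
  also have "\<dots> = m0 * (1 + t * (mq / m0 - 1))"
    using assms(2) by (simp add: m0_def field_simps)
  finally have m: "prior_predictive M f x (contaminated \<pi>0 q t) = m0 * (1 + t * (mq / m0 - 1))" .
  have c: "contaminated \<pi>0 q t \<theta> = \<pi>0 \<theta> * (1 + t * (q \<theta> / \<pi>0 \<theta> - 1))"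
    using assms(5) by (simp add: contaminated_def field_simps)
  show ?thesis
    unfolding posterior_def m c by (simp add: m0_def mq_def)
qed

text \<open>Both cases are f-divergence integrands \<open>p0 * h (p / p0)\<close>; for powers this
  uses \<open>p0 powr a * p0 powr (1 - a) = p0\<close>.\<close>

lemma renyi_integrand_mult:
  assumes "0 < p0 \<theta>" "0 < u" "p \<theta> = p0 \<theta> * u"
  shows "renyi_integrand a p p0 \<theta> = p0 \<theta> * (if a = 1 then u * ln u else u powr a)"
proof -
  have "p0 \<theta> powr a * p0 \<theta> powr (1 - a) = p0 \<theta>"
    using assms(1) by (simp flip: powr_add)
  then show ?thesis
    using assms by (simp add: renyi_integrand_def powr_mult mult_ac)
qed

theorem theorem1:
  fixes M :: "'t measure" and N :: "'x measure"
    and f :: "'t \<Rightarrow> 'x \<Rightarrow> real" and x :: 'x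
    and \<pi>0 q :: "'t \<Rightarrow> real" and Q :: "('t \<Rightarrow> real) set"
    and a \<epsilon>0 :: real
  assumes "\<And>\<theta>. \<theta> \<in> space M \<Longrightarrow> prob_density N (f \<theta>)"
    and "x \<in> space N"
    and "prob_density M \<pi>0" and "\<And>\<theta>. \<theta> \<in> space M \<Longrightarrow> 0 < \<pi>0 \<theta>"
    and "\<And>p. p \<in> Q \<Longrightarrow> prob_density M p"
    and "q \<in> Q" and "\<And>\<theta>. \<theta> \<in> space M \<Longrightarrow> 0 < q \<theta>"
    and "integrable M (\<lambda>\<theta>. f \<theta> x * \<pi>0 \<theta>)" and "0 < prior_predictive M f x \<pi>0"
    and "integrable M (\<lambda>\<theta>. f \<theta> x * q \<theta>)" and "0 < prior_predictive M f x q"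
    and "0 < a" and "0 < \<epsilon>0" and "\<epsilon>0 \<le> 1"
    and "twice_diff_under_integral M (likelihood_support M f x) {0..<\<epsilon>0}
           (\<lambda>\<epsilon>. posterior M f x (contaminated \<pi>0 q \<epsilon>))"
    and "twice_diff_under_integral M (likelihood_support M f x) {0..<\<epsilon>0}
           (\<lambda>\<epsilon>. renyi_integrand a (posterior M f x (contaminated \<pi>0 q \<epsilon>)) (posterior M f x \<pi>0))"
  shows "integrable (density M (posterior M f x \<pi>0)) (\<lambda>\<theta>. (q \<theta> / \<pi>0 \<theta>)\<^sup>2) \<and>
    has_second_right_derivative
      (\<lambda>\<epsilon>. renyi_divergence M (likelihood_support M f x) a
              (posterior M f x (contaminated \<pi>0 q \<epsilon>)) (posterior M f x \<pi>0))
      (a * prob_space.variance (density M (posterior M f x \<pi>0)) (\<lambda>\<theta>. q \<theta> / \<pi>0 \<theta>)) 0"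
proof -
  note int0 = assms(8) and intq = assms(10) and m0 = assms(9) and mq = assms(11)
  define A where "A = likelihood_support M f x"
  define R where "R = prior_predictive M f x q / prior_predictive M f x \<pi>0"
  define r where "r \<theta> = q \<theta> / \<pi>0 \<theta>" for \<theta>
  define p0 where "p0 = posterior M f x \<pi>0"
  define u where "u t \<theta> = (1 + t * (r \<theta> - 1)) / (1 + t * (R - 1))" for t \<theta>
  define h where "h v = (if a = 1 then v * ln v else v powr a)" for v :: real
  define h' where "h' v = (if a = 1 then ln v + 1 else a * v powr (a - 1))" for v :: real
  define h2 where "h2 = (if a = 1 then 1 else a * (a - 1))"
  define I where "I = {0..<\<epsilon>0}"
  define p where "p t = posterior M f x (contaminated \<pi>0 q t)" for t
  have h2: "h2 \<noteq> 0" using assms(12) by (simp add: h2_def)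
  have dh: "(h has_real_derivative h' v) (at v)" if "0 < v" for v
    using that unfolding h_def h'_def
    by (cases "a = 1") (auto intro!: derivative_eq_intros)
  have dh': "(h' has_real_derivative h2) (at 1)"
    unfolding h'_def h2_def
    by (cases "a = 1") (auto intro!: derivative_eq_intros)
  have R: "0 < R" using m0 mq by (simp add: R_def)
  have r: "0 < r \<theta>" if "\<theta> \<in> space M" for \<theta>
    using assms(4,7) that by (simp add: r_def)
  have fnn: "0 \<le> f \<theta> x" if "\<theta> \<in> space M" for \<theta>
    using assms(1)[OF that] assms(2) by (simp add: prob_density_def)
  have A: "\<theta> \<in> space M" "0 < p0 \<theta>" if "\<theta> \<in> A" for \<theta>
    using that m0 assms(4) by (auto simp: A_def likelihood_support_def p0_def posterior_def)
  have off_A: "p0 \<theta> = 0" if "\<theta> \<in> space M" "\<theta> \<notin> A" for \<theta>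
    using that fnn[of \<theta>] by (auto simp: A_def likelihood_support_def p0_def posterior_def)
  have p0_nn: "0 \<le> p0 \<theta>" if "\<theta> \<in> space M" for \<theta>
    using A[of \<theta>] off_A[of \<theta>] that by fastforce

  have meas [measurable]: "\<pi>0 \<in> borel_measurable M" "q \<in> borel_measurable M"
    using assms(3) assms(5)[OF assms(6)] by (auto simp: prob_density_def)
  have meas_r [measurable]: "r \<in> borel_measurable M"
    unfolding r_def by measurable
  have int_p0: "integrable M p0" "(LINT \<theta>|M. p0 \<theta>) = 1"
    using int0 m0 by (simp_all add: p0_def posterior_def[abs_def] prior_predictive_def)
  have meas_p0 [measurable]: "p0 \<in> borel_measurable M"
    using int_p0 by auto
  \<comment> \<open>The factor \<open>\<pi>0\<close> cancels, which makes \<open>R\<close> the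
    posterior mean of \<open>r\<close>.\<close>
  have p0r: "p0 \<theta> * r \<theta> = f \<theta> x * q \<theta> / prior_predictive M f x \<pi>0" if "\<theta> \<in> space M" for \<theta>
    using assms(4)[OF that] by (simp add: p0_def posterior_def r_def)
  have int_p0r: "integrable M (\<lambda>\<theta>. p0 \<theta> * r \<theta>)" "(LINT \<theta>|M. p0 \<theta> * r \<theta>) = R"
    using intq
    by (simp_all add: p0r R_def prior_predictive_def cong: Bochner_Integration.integrable_cong
        Bochner_Integration.integral_cong)
  have int_centred: "integrable M (\<lambda>\<theta>. p0 \<theta> * (r \<theta> - R))" "(LINT \<theta>|M. p0 \<theta> * (r \<theta> - R)) = 0"
    using int_p0 int_p0r by (simp_all add: right_diff_distrib)

  have p_eq: "p t \<theta> = p0 \<theta> * u t \<theta>" if "\<theta> \<in> space M" "t \<in> I" for t \<theta>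
    unfolding p_def p0_def u_def r_def R_def
    using that assms(4,14) by (intro posterior_contaminated int0 intq m0 mq) (auto simp: I_def)
  have integrand: "renyi_integrand a (p t) p0 \<theta> = p0 \<theta> * h (u t \<theta>)" if "\<theta> \<in> A" "t \<in> I" for t \<theta>
  proof -
    have "0 < u t \<theta>"
      using that assms(14) mixture_weight_pos[OF r[OF A(1)[OF that(1)]], of t]
        mixture_weight_pos[OF R, of t]
      by (simp add: u_def I_def)
    then show ?thesis
      unfolding h_def using A that p_eq by (intro renyi_integrand_mult) auto
  qed

  have "0 \<in> I" using assms(13) by (simp add: I_def)
  obtain g1 g2 where g:
    "\<forall>t\<in>I. \<forall>\<theta>\<in>A.
      ((\<lambda>t. renyi_integrand a (p t) p0 \<theta>) has_real_derivative g1 t \<theta>) (at t within I)"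
    "\<forall>t\<in>I. \<forall>\<theta>\<in>A.
      ((\<lambda>t. g1 t \<theta>) has_real_derivative g2 t \<theta>) (at t within I)"
    "\<forall>t\<in>I. set_integrable M A (g2 t)"
    "\<forall>t\<in>I. ((\<lambda>t. LINT \<theta>:A|M. renyi_integrand a (p t) p0 \<theta>) has_real_derivative
      (LINT \<theta>:A|M. g1 t \<theta>)) (at t within I)"
    "\<forall>t\<in>I. ((\<lambda>t. LINT \<theta>:A|M. g1 t \<theta>) has_real_derivative
      (LINT \<theta>:A|M. g2 t \<theta>)) (at t within I)"
    using twice_diff_under_integralE[OF assms(16)[folded I_def A_def p_def p0_def]] .
  note g2_0 = bspec[OF bspec[OF g(2) \<open>0 \<in> I\<close>]] bspec[OF g(3) \<open>0 \<in> I\<close>] bspec[OF g(5) \<open>0 \<in> I\<close>]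
  have g_at_0: "g1 0 \<theta> = p0 \<theta> * (h' 1 * (r \<theta> - R))"
      "g2 0 \<theta> = p0 \<theta> * (h2 * (r \<theta> - R)\<^sup>2 - 2 * h' 1 * (R - 1) * (r \<theta> - R))"
    if "\<theta> \<in> A" for \<theta>
  proof -
    note comp = right_derivatives_comp_mixture_ratio[OF r[OF A(1)[OF that]] R assms(13,14) dh dh',
        where g = "\<lambda>t. renyi_integrand a (p t) p0 \<theta>" and p = "p0 \<theta>" and g' = "\<lambda>t. g1 t \<theta>"
          and D = "g2 0 \<theta>", folded I_def, OF _ _ g(1)[rule_format, OF _ that] g2_0(1)[OF that]]
    show "g1 0 \<theta> = p0 \<theta> * (h' 1 * (r \<theta> - R))"
      "g2 0 \<theta> = p0 \<theta> * (h2 * (r \<theta> - R)\<^sup>2 - 2 * h' 1 * (R - 1) * (r \<theta> - R))"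
      using comp integrand[OF that] by (simp_all add: u_def)
  qed
  \<comment> \<open>As \<open>p0\<close> vanishes off \<open>A\<close>, integrals over
    \<open>A\<close> of multiples of \<open>p0\<close> become integrals over all of
    \<open>M\<close>.\<close>
  have on_A: "indicator A \<theta> *\<^sub>R F \<theta> = p0 \<theta> * k \<theta>"
    if "\<theta> \<in> space M" "\<And>\<theta>. \<theta> \<in> A \<Longrightarrow> F \<theta> = p0 \<theta> * k \<theta>" for F k \<theta>
    using that off_A[of \<theta>] by (cases "\<theta> \<in> A") auto
  have set_int: "(LINT \<theta>:A|M. F \<theta>) = (LINT \<theta>|M. p0 \<theta> * k \<theta>)"
    if "\<And>\<theta>. \<theta> \<in> A \<Longrightarrow> F \<theta> = p0 \<theta> * k \<theta>" for F k
    unfolding set_lebesgue_integral_def using on_A that by (intro Bochner_Integration.integral_cong) auto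

  \<comment> \<open>Finiteness of the variance is extracted from integrability of
    \<open>g2 0\<close>: remove the linear term, integrable by \<open>int_centred\<close>, and
    divide by \<open>h2\<close>, which is nonzero.\<close>
  have "integrable M (\<lambda>\<theta>. p0 \<theta> * (h2 * (r \<theta> - R)\<^sup>2 - 2 * h' 1 * (R - 1) * (r \<theta> - R)))"
    using g2_0(2) on_A[OF _ g_at_0(2)] unfolding set_integrable_def
    by (subst (asm) Bochner_Integration.integrable_cong[OF refl]) auto
  then have "integrable M (\<lambda>\<theta>. inverse h2 *
      (p0 \<theta> * (h2 * (r \<theta> - R)\<^sup>2 - 2 * h' 1 * (R - 1) * (r \<theta> - R))
        + 2 * h' 1 * (R - 1) * (p0 \<theta> * (r \<theta> - R))))"
    using int_centred(1)
    by (intro integrable_mult_right Bochner_Integration.integrable_add)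
  moreover have "inverse h2 * (p0 \<theta> * (h2 * (r \<theta> - R)\<^sup>2 - 2 * h' 1 * (R - 1) * (r \<theta> - R))
      + 2 * h' 1 * (R - 1) * (p0 \<theta> * (r \<theta> - R))) = p0 \<theta> * (r \<theta> - R)\<^sup>2" for \<theta>
    using h2 by (simp add: field_simps)
  ultimately have int_sq: "integrable M (\<lambda>\<theta>. p0 \<theta> * (r \<theta> - R)\<^sup>2)"
    by simp
  have "integrable M (\<lambda>\<theta>. p0 \<theta> * (r \<theta> - R)\<^sup>2 + 2 * R * (p0 \<theta> * r \<theta>) - R\<^sup>2 * p0 \<theta>)"
    using int_sq int_p0r(1) int_p0(1) by simp
  then have "integrable M (\<lambda>\<theta>. p0 \<theta> * (r \<theta>)\<^sup>2)"
    by (simp add: power2_eq_square algebra_simps)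
  then have sq_integrable: "integrable (density M p0) (\<lambda>\<theta>. (r \<theta>)\<^sup>2)"
    using p0_nn by (subst integrable_density) auto

  have dens: "integral\<^sup>L (density M p0) F = (LINT \<theta>|M. p0 \<theta> * F \<theta>)"
    if "F \<in> borel_measurable M" for F :: "'t \<Rightarrow> real"
    using that p0_nn by (subst integral_density) auto
  define V where "V = prob_space.variance (density M p0) r"
  have V: "V = (LINT \<theta>|M. p0 \<theta> * (r \<theta> - R)\<^sup>2)"
    using int_p0r(2) by (simp add: V_def dens)
  have "(LINT \<theta>:A|M. g1 0 \<theta>) = (LINT \<theta>|M. h' 1 * (p0 \<theta> * (r \<theta> - R)))"
    using set_int[OF g_at_0(1)] by (simp add: mult_ac)
  then have G1: "(LINT \<theta>:A|M. g1 0 \<theta>) = 0"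
    using int_centred(2) by simp
  have "(LINT \<theta>:A|M. g2 0 \<theta>) =
      (LINT \<theta>|M. h2 * (p0 \<theta> * (r \<theta> - R)\<^sup>2) - 2 * h' 1 * (R - 1) * (p0 \<theta> * (r \<theta> - R)))"
    using set_int[OF g_at_0(2)] by (simp add: algebra_simps)
  also have "\<dots> = h2 * V"
    using int_sq int_centred by (simp add: V)
  finally have G2: "(LINT \<theta>:A|M. g2 0 \<theta>) = h2 * V" .

  have "has_second_right_derivative (\<lambda>t. renyi_divergence M A a (p t) p0) (a * V) 0"
  proof (cases "a = 1")
    case True
    \<comment> \<open>Here the divergence is the integral itself, so \<open>\<epsilon>0\<close>
      serves as the interval length without shrinking.\<close>
    then have "a * V = h2 * V" by (simp add: h2_def)
    then show ?thesis
      using g(4) g2_0(3) G2 assms(13) True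
      unfolding has_second_right_derivative_def renyi_divergence_def I_def
      by (intro exI[of _ \<epsilon>0] conjI exI[of _ "\<lambda>t. LINT \<theta>:A|M. g1 t \<theta>"]) auto
  next
    case False
    \<comment> \<open>At 0 the ratio \<open>u\<close> is 1 and \<open>h 1 = 1\<close>, so the
      integral is the total posterior mass; the factor 1 matches the shape of
      \<open>set_int\<close>.\<close>
    have "(LINT \<theta>:A|M. renyi_integrand a (p 0) p0 \<theta>) = (LINT \<theta>|M. p0 \<theta> * 1)"
      using integrand \<open>0 \<in> I\<close> False by (intro set_int) (auto simp: u_def h_def)
    then have "has_second_right_derivative
        (\<lambda>t. 1 / (a - 1) * ln (LINT \<theta>:A|M. renyi_integrand a (p t) p0 \<theta>))
        (1 / (a - 1) * (LINT \<theta>:A|M. g2 0 \<theta>)) 0"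
      using g(4) g2_0(3) G1 int_p0(2) assms(13)
      by (intro has_second_right_derivative_ln[where e = \<epsilon>0 and ?G1.0 = "\<lambda>t. LINT \<theta>:A|M. g1 t \<theta>"])
          (auto simp: I_def)
    \<comment> \<open>The prefactor of the divergence cancels the \<open>a - 1\<close> in
      \<open>h2 = a * (a - 1)\<close>.\<close>
    moreover have "1 / (a - 1) * (LINT \<theta>:A|M. g2 0 \<theta>) = a * V"
      using False by (simp add: G2 h2_def)
    ultimately show ?thesis
      using False by (simp add: renyi_divergence_def)
  qed
  then show ?thesis
    using sq_integrable unfolding V_def r_def p0_def A_def p_def by simp
qed

end
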